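(* Let $\Gamma=\langle \alpha_1,\ldots,\alpha_k\rangle\subset\mathbb N^d$ be an affine semigroup with minimal generators $\alpha_1,\ldots,\alpha_k$, let $\mathbb K$ be a field, and let $\Gamma_H=\langle (1,0),(1,\alpha_1),\ldots,(1,\alpha_k)\rangle\subset\mathbb N^{d+1}$. Let $\mathrm I_{\Gamma_H}\subset\mathbb K[t,y_1,\ldots,y_k]$ be the kernel of the ring homomorphism $\mathbb K[t,y_1,\ldots,y_k]\to\mathbb K[s_0,s_1,\ldots,s_d]$ given by $t\mapsto s_0$ and $y_i\mapsto s_0 s^{\alpha_i}$. Let $G$ be a reduced Gröbner basis of $\mathrm I_{\Gamma_H}$ with respect to a lexicographic monomial order with $t>y_i$ for every $i\le k$. For $j\ge 0$ let $$I_j=\big\langle y^z-y^w : \gamma\in\Gamma,\ z,w\in\mathsf Z(\gamma),\ \big||w|-|z|\big|\le j\big\rangle\subset\mathbb K[y_1,\ldots,y_k]$$ and $$J_j=\big\langle y^z-y^w : i\in\mathbb N,\ z,w\in\mathbb N^k,\ t^iy^z-y^w\in G,\ i\le j\big\rangle.$$ Then $I_j=J_j$ for every $j\ge 0$.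
   Context: An affine semigroup is a finitely generated submonoid of $\mathbb N^d$, with unique minimal generating set $\alpha_1,\ldots,\alpha_k$. A factorization of $\gamma\in\Gamma$ is $z\in\mathbb N^k$ with $z_1\alpha_1+\cdots+z_k\alpha_k=\gamma$; $\mathsf Z(\gamma)$ denotes the set of factorizations, and $|z|=z_1+\cdots+z_k$. For $z\in\mathbb N^k$, $y^z=y_1^{z_1}\cdots y_k^{z_k}$, and for $\alpha\in\mathbb N^d$, $s^{\alpha}=s_1^{\alpha_1}\cdots s_d^{\alpha_d}$. *)

theory Defs
  imports "HOL-Library.Poly_Mapping" "HOL-Algebra.RingHom"
begin

text \<open>
  Variables are indexed by natural numbers. Exponent vectors are finitely supported maps
  \<open>nat \<Rightarrow>\<^sub>0 nat\<close> and polynomials are finitely supported maps from exponent vectors to coefficients.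
  The lattice \<open>\<nat>\<^sup>X\<close> and the polynomial ring \<open>K[X]\<close> are carved out by the variable set \<open>X\<close>:
  \<open>\<nat>\<^sup>d\<close> is \<open>expvecs {1..d}\<close>, \<open>K[y\<^sub>1,\<dots>,y\<^sub>k]\<close> is \<open>mpoly_ring {1..k}\<close>, and the index \<open>0\<close> is reserved for
  \<open>t\<close> and \<open>s\<^sub>0\<close>, so that \<open>K[t,y\<^sub>1,\<dots>,y\<^sub>k]\<close> is \<open>mpoly_ring {0..k}\<close>. In this way
  \<open>K[y\<^sub>1,\<dots>,y\<^sub>k]\<close> is literally a subring of \<open>K[t,y\<^sub>1,\<dots>,y\<^sub>k]\<close>.
\<close>

type_synonym expvec = "nat \<Rightarrow>\<^sub>0 nat"
type_synonym 'a mpol = "expvec \<Rightarrow>\<^sub>0 'a"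

definition expvecs :: "nat set \<Rightarrow> expvec set" where
  "expvecs X = {m. Poly_Mapping.keys m \<subseteq> X}"

definition total_degree :: "expvec \<Rightarrow> nat" where
  "total_degree z = (\<Sum>v\<in>Poly_Mapping.keys z. Poly_Mapping.lookup z v)"

definition mpoly_ring :: "nat set \<Rightarrow> 'a::comm_ring_1 mpol ring" where
  "mpoly_ring X =
     \<lparr>carrier = {p. Poly_Mapping.keys p \<subseteq> expvecs X},
      monoid.mult = (*), one = 1, zero = 0, add = (+)\<rparr>"

definition monom :: "expvec \<Rightarrow> 'a::comm_ring_1 mpol" where
  "monom m = Poly_Mapping.single m 1"

definition var :: "nat \<Rightarrow> 'a::comm_ring_1 mpol" where
  "var v = monom (Poly_Mapping.single v 1)"

definition const :: "'a \<Rightarrow> 'a::comm_ring_1 mpol" where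
  "const c = Poly_Mapping.single 0 c"

definition poly_subst :: "(nat \<Rightarrow> 'a mpol) \<Rightarrow> 'a mpol \<Rightarrow> 'a::comm_ring_1 mpol" where
  "poly_subst \<sigma> p =
     (\<Sum>m\<in>Poly_Mapping.keys p. const (Poly_Mapping.lookup p m) *
        (\<Prod>v\<in>Poly_Mapping.keys m. \<sigma> v ^ Poly_Mapping.lookup m v))"


subsection \<open>Affine semigroups and factorizations\<close>

inductive_set submonoid_span :: "expvec set \<Rightarrow> expvec set" for S where
  zero: "0 \<in> submonoid_span S"
| gen: "a \<in> S \<Longrightarrow> a \<in> submonoid_span S"
| add: "a \<in> submonoid_span S \<Longrightarrow> b \<in> submonoid_span S \<Longrightarrow> a + b \<in> submonoid_span S"

definition affine_semigroup :: "nat \<Rightarrow> expvec set \<Rightarrow> bool" where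
  "affine_semigroup d \<Gamma> \<longleftrightarrow>
     \<Gamma> \<subseteq> expvecs {1..d} \<and> (\<exists>S. finite S \<and> \<Gamma> = submonoid_span S)"

definition minimal_generators :: "nat \<Rightarrow> (nat \<Rightarrow> expvec) \<Rightarrow> expvec set \<Rightarrow> bool" where
  "minimal_generators k \<alpha> \<Gamma> \<longleftrightarrow>
     inj_on \<alpha> {1..k} \<and> submonoid_span (\<alpha> ` {1..k}) = \<Gamma> \<and>
     (\<forall>T. T \<subset> \<alpha> ` {1..k} \<longrightarrow> submonoid_span T \<noteq> \<Gamma>)"

text \<open>The equation \<open>z\<^sub>1 \<alpha>\<^sub>1 + \<dots> + z\<^sub>k \<alpha>\<^sub>k = \<gamma>\<close> is written out coordinatewise.\<close>

definition factorizations :: "nat \<Rightarrow> (nat \<Rightarrow> expvec) \<Rightarrow> expvec \<Rightarrow> expvec set" where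
  "factorizations k \<alpha> \<gamma> =
     {z \<in> expvecs {1..k}. \<forall>c.
        (\<Sum>i=1..k. Poly_Mapping.lookup z i * Poly_Mapping.lookup (\<alpha> i) c) =
        Poly_Mapping.lookup \<gamma> c}"


subsection \<open>Reduced Groebner bases\<close>

text \<open>A pair \<open>(u, v)\<close> in the variable order \<open>r\<close> means that \<open>v\<close> is at least as large as \<open>u\<close>.\<close>

definition lex_less :: "nat set \<Rightarrow> nat rel \<Rightarrow> expvec \<Rightarrow> expvec \<Rightarrow> bool" where
  "lex_less X r m n \<longleftrightarrow>
     (\<exists>v\<in>X. Poly_Mapping.lookup m v < Poly_Mapping.lookup n v \<and>
        (\<forall>u\<in>X. (v, u) \<in> r \<and> u \<noteq> v \<longrightarrow> Poly_Mapping.lookup m u = Poly_Mapping.lookup n u))"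

definition lead_monom :: "(expvec \<Rightarrow> expvec \<Rightarrow> bool) \<Rightarrow> 'a::comm_ring_1 mpol \<Rightarrow> expvec" where
  "lead_monom lt p =
     (THE m. m \<in> Poly_Mapping.keys p \<and> (\<forall>n\<in>Poly_Mapping.keys p. n \<noteq> m \<longrightarrow> lt n m))"

definition lead_coeff :: "(expvec \<Rightarrow> expvec \<Rightarrow> bool) \<Rightarrow> 'a::comm_ring_1 mpol \<Rightarrow> 'a" where
  "lead_coeff lt p = Poly_Mapping.lookup p (lead_monom lt p)"

definition lead_term :: "(expvec \<Rightarrow> expvec \<Rightarrow> bool) \<Rightarrow> 'a::comm_ring_1 mpol \<Rightarrow> 'a mpol" where
  "lead_term lt p = Poly_Mapping.single (lead_monom lt p) (lead_coeff lt p)"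

definition lead_ideal ::
  "nat set \<Rightarrow> (expvec \<Rightarrow> expvec \<Rightarrow> bool) \<Rightarrow> 'a::comm_ring_1 mpol set \<Rightarrow> 'a mpol set" where
  "lead_ideal X lt F = Idl\<^bsub>mpoly_ring X\<^esub> (lead_term lt ` (F - {0}))"

definition groebner_basis ::
  "nat set \<Rightarrow> (expvec \<Rightarrow> expvec \<Rightarrow> bool) \<Rightarrow> 'a::field mpol set \<Rightarrow> 'a mpol set \<Rightarrow> bool" where
  "groebner_basis X lt I G \<longleftrightarrow>
     finite G \<and> G \<subseteq> I \<and> lead_ideal X lt G = lead_ideal X lt I"

definition reduced_groebner_basis ::
  "nat set \<Rightarrow> (expvec \<Rightarrow> expvec \<Rightarrow> bool) \<Rightarrow> 'a::field mpol set \<Rightarrow> 'a mpol set \<Rightarrow> bool" where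
  "reduced_groebner_basis X lt I G \<longleftrightarrow>
     groebner_basis X lt I G \<and> 0 \<notin> G \<and>
     (\<forall>g\<in>G. lead_coeff lt g = 1 \<and>
        (\<forall>m\<in>Poly_Mapping.keys g. monom m \<notin> lead_ideal X lt (G - {g})))"


subsection \<open>The ideals\<close>

definition homog_image :: "(nat \<Rightarrow> expvec) \<Rightarrow> nat \<Rightarrow> 'a::comm_ring_1 mpol" where
  "homog_image \<alpha> v = (if v = 0 then var 0 else var 0 * monom (\<alpha> v))"

definition homog_toric_ideal ::
  "nat \<Rightarrow> nat \<Rightarrow> (nat \<Rightarrow> expvec) \<Rightarrow> 'a::field mpol set" where
  "homog_toric_ideal d k \<alpha> =
     a_kernel (mpoly_ring {0..k}) (mpoly_ring {0..d}) (poly_subst (homog_image \<alpha>))"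

definition length_diff_ideal ::
  "nat \<Rightarrow> (nat \<Rightarrow> expvec) \<Rightarrow> expvec set \<Rightarrow> nat \<Rightarrow> 'a::field mpol set" where
  "length_diff_ideal k \<alpha> \<Gamma> j =
     Idl\<^bsub>mpoly_ring {1..k}\<^esub> {monom z - monom w | \<gamma> z w.
        \<gamma> \<in> \<Gamma> \<and> z \<in> factorizations k \<alpha> \<gamma> \<and> w \<in> factorizations k \<alpha> \<gamma> \<and>
        \<bar>int (total_degree w) - int (total_degree z)\<bar> \<le> int j}"

definition basis_ideal :: "nat \<Rightarrow> 'a::field mpol set \<Rightarrow> nat \<Rightarrow> 'a mpol set" where
  "basis_ideal k G j =
     Idl\<^bsub>mpoly_ring {1..k}\<^esub> {monom z - monom w | i z w.
        z \<in> expvecs {1..k} \<and> w \<in> expvecs {1..k} \<and>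
        var 0 ^ i * monom z - monom w \<in> G \<and> i \<le> j}"


subsection \<open>Basic facts\<close>

lemma expvecs_0: "0 \<in> expvecs X"
  by (simp add: expvecs_def)

lemma expvecs_add: "m \<in> expvecs X \<Longrightarrow> n \<in> expvecs X \<Longrightarrow> m + n \<in> expvecs X"
  using Poly_Mapping.keys_add[of m n] by (auto simp: expvecs_def)

lemma mpoly_ring_simps [simp]:
  "carrier (mpoly_ring X) = {p. Poly_Mapping.keys p \<subseteq> expvecs X}"
  "x \<otimes>\<^bsub>mpoly_ring X\<^esub> y = x * y"
  "x \<oplus>\<^bsub>mpoly_ring X\<^esub> y = x + y"
  "\<one>\<^bsub>mpoly_ring X\<^esub> = 1"
  "\<zero>\<^bsub>mpoly_ring X\<^esub> = 0"
  by (simp_all add: mpoly_ring_def)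

lemma mpoly_mult_closed:
  "Poly_Mapping.keys p \<subseteq> expvecs X \<Longrightarrow> Poly_Mapping.keys q \<subseteq> expvecs X \<Longrightarrow>
   Poly_Mapping.keys (p * q) \<subseteq> expvecs X"
  using Poly_Mapping.keys_mult[of p q] expvecs_add[of _ X] by fastforce

lemma mpoly_add_closed:
  "Poly_Mapping.keys p \<subseteq> expvecs X \<Longrightarrow> Poly_Mapping.keys q \<subseteq> expvecs X \<Longrightarrow>
   Poly_Mapping.keys (p + q) \<subseteq> expvecs X"
  using Poly_Mapping.keys_add[of p q] by auto

lemma cring_mpoly_ring: "cring (mpoly_ring X :: 'a::comm_ring_1 mpol ring)"
proof (rule cringI)
  show "abelian_group (mpoly_ring X :: 'a mpol ring)"
  proof (rule abelian_groupI)
    fix p :: "'a mpol"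
    assume "p \<in> carrier (mpoly_ring X)"
    then show "\<exists>q\<in>carrier (mpoly_ring X). q \<oplus>\<^bsub>mpoly_ring X\<^esub> p = \<zero>\<^bsub>mpoly_ring X\<^esub>"
      by (intro bexI[of _ "- p"]) auto
  qed (simp_all add: ac_simps mpoly_add_closed)
  show "comm_monoid (mpoly_ring X :: 'a mpol ring)"
    by (rule comm_monoidI) (simp_all add: ac_simps expvecs_0 mpoly_mult_closed)
qed (simp add: algebra_simps)

lemma poly_subst_superset:
  assumes "finite A" "Poly_Mapping.keys p \<subseteq> A"
  shows "poly_subst \<sigma> p =
     (\<Sum>m\<in>A. const (Poly_Mapping.lookup p m) *
        (\<Prod>v\<in>Poly_Mapping.keys m. \<sigma> v ^ Poly_Mapping.lookup m v))"
  unfolding poly_subst_def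
  by (rule sum.mono_neutral_left) (use assms in \<open>auto simp: in_keys_iff const_def\<close>)

lemma poly_subst_add: "poly_subst \<sigma> (p + q) = poly_subst \<sigma> p + poly_subst \<sigma> q"
proof -
  let ?A = "Poly_Mapping.keys p \<union> Poly_Mapping.keys q"
  have "finite ?A" "Poly_Mapping.keys (p + q) \<subseteq> ?A"
    using Poly_Mapping.keys_add[of p q] by auto
  then show ?thesis
    by (simp add: poly_subst_superset[of ?A] const_def lookup_add single_add
        distrib_right sum.distrib)
qed

lemma poly_subst_var: "poly_subst \<sigma> (var v) = \<sigma> v"
  by (simp add: poly_subst_def var_def monom_def const_def)

lemma poly_subst_const: "poly_subst \<sigma> (const c) = const c"
  by (simp add: poly_subst_def const_def)

lemma exp_subst_superset:
  assumes "finite A" "Poly_Mapping.keys m \<subseteq> A"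
  shows "(\<Prod>v\<in>Poly_Mapping.keys m. \<sigma> v ^ Poly_Mapping.lookup m v) =
     (\<Prod>v\<in>A. (\<sigma> v :: 'a::comm_ring_1 mpol) ^ Poly_Mapping.lookup m v)"
  by (rule prod.mono_neutral_left) (use assms in \<open>auto simp: in_keys_iff\<close>)

lemma exp_subst_add:
  "(\<Prod>v\<in>Poly_Mapping.keys (m + n). (\<sigma> v :: 'a::comm_ring_1 mpol) ^ Poly_Mapping.lookup (m + n) v) =
   (\<Prod>v\<in>Poly_Mapping.keys m. \<sigma> v ^ Poly_Mapping.lookup m v) *
   (\<Prod>v\<in>Poly_Mapping.keys n. \<sigma> v ^ Poly_Mapping.lookup n v)"
proof -
  let ?A = "Poly_Mapping.keys m \<union> Poly_Mapping.keys n"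
  have "finite ?A" "Poly_Mapping.keys (m + n) \<subseteq> ?A"
    using Poly_Mapping.keys_add[of m n] by auto
  then show ?thesis
    by (simp only: exp_subst_superset[of ?A] Un_upper1 Un_upper2)
       (simp add: lookup_add power_add prod.distrib)
qed

lemma poly_subst_single:
  "poly_subst \<sigma> (Poly_Mapping.single m c) =
   const c * (\<Prod>v\<in>Poly_Mapping.keys m. \<sigma> v ^ Poly_Mapping.lookup m v)"
  by (simp add: poly_subst_superset[of "{m}"])

lemma poly_subst_0: "poly_subst \<sigma> 0 = 0"
  by (simp add: poly_subst_def)

lemma poly_subst_sum: "poly_subst \<sigma> (sum f A) = (\<Sum>x\<in>A. poly_subst \<sigma> (f x))"
  by (induction A rule: infinite_finite_induct) (simp_all add: poly_subst_0 poly_subst_add)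

lemma mpol_sum_monomials:
  "(p :: 'a::comm_ring_1 mpol) =
   (\<Sum>m\<in>Poly_Mapping.keys p. Poly_Mapping.single m (Poly_Mapping.lookup p m))"
  by (rule poly_mapping_eqI)
     (simp add: lookup_sum lookup_single when_def in_keys_iff)

lemma poly_subst_mult: "poly_subst \<sigma> (p * q) = poly_subst \<sigma> p * poly_subst \<sigma> q"
proof -
  have single: "poly_subst \<sigma> (Poly_Mapping.single m a * Poly_Mapping.single n b) =
      poly_subst \<sigma> (Poly_Mapping.single m a) * poly_subst \<sigma> (Poly_Mapping.single n b)" for m n a b
  proof -
    have "const (a * b) = const a * const b"
      by (simp add: const_def mult_single)
    then show ?thesis
      by (simp add: mult_single poly_subst_single exp_subst_add mult_ac)
  qed
  have "p * q = (\<Sum>m\<in>Poly_Mapping.keys p. Poly_Mapping.single m (Poly_Mapping.lookup p m)) *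
      (\<Sum>n\<in>Poly_Mapping.keys q. Poly_Mapping.single n (Poly_Mapping.lookup q n))"
    using mpol_sum_monomials[of p] mpol_sum_monomials[of q] by argo
  also have "poly_subst \<sigma> \<dots> =
      poly_subst \<sigma> (\<Sum>m\<in>Poly_Mapping.keys p. Poly_Mapping.single m (Poly_Mapping.lookup p m)) *
      poly_subst \<sigma> (\<Sum>n\<in>Poly_Mapping.keys q. Poly_Mapping.single n (Poly_Mapping.lookup q n))"
    by (simp add: sum_product poly_subst_sum single)
  finally show ?thesis
    using mpol_sum_monomials[of p] mpol_sum_monomials[of q] by argo
qed

lemma poly_subst_closed:
  assumes "Poly_Mapping.keys p \<subseteq> expvecs X"
    and "\<And>v. v \<in> X \<Longrightarrow> Poly_Mapping.keys (\<sigma> v) \<subseteq> expvecs Y"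
  shows "Poly_Mapping.keys (poly_subst \<sigma> p) \<subseteq> expvecs Y"
proof -
  have pow: "Poly_Mapping.keys (\<sigma> v ^ n) \<subseteq> expvecs Y" if "v \<in> X" for v n
    by (induction n) (use that assms(2) in \<open>simp_all add: expvecs_0 mpoly_mult_closed\<close>)
  have prod: "Poly_Mapping.keys (\<Prod>v\<in>A. \<sigma> v ^ f v) \<subseteq> expvecs Y" if "A \<subseteq> X" for A f
    using that by (induction A rule: infinite_finite_induct)
      (simp_all add: expvecs_0 mpoly_mult_closed pow)
  have sum: "Poly_Mapping.keys (\<Sum>m\<in>A. const (c m) *
      (\<Prod>v\<in>Poly_Mapping.keys m. \<sigma> v ^ Poly_Mapping.lookup m v)) \<subseteq> expvecs Y"
    if "A \<subseteq> expvecs X" for A c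
    using that
  proof (induction A rule: infinite_finite_induct)
    case (insert m A)
    then have "Poly_Mapping.keys m \<subseteq> X"
      by (auto simp: expvecs_def)
    with insert show ?case
      by (simp, intro mpoly_add_closed mpoly_mult_closed prod) (auto simp: const_def expvecs_0)
  qed auto
  show ?thesis
    unfolding poly_subst_def by (rule sum) (rule assms(1))
qed

lemma homog_image_ring_hom:
  assumes "\<And>i. i \<in> {1..k} \<Longrightarrow> \<alpha> i \<in> expvecs {1..d}"
  shows "poly_subst (homog_image \<alpha> :: nat \<Rightarrow> 'a::comm_ring_1 mpol)
           \<in> ring_hom (mpoly_ring {0..k}) (mpoly_ring {0..d})"
proof (rule ring_hom_memI)
  have "Poly_Mapping.keys (homog_image \<alpha> v :: 'a mpol) \<subseteq> expvecs {0..d}" if "v \<in> {0..k}" for v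
  proof -
    have 1: "Poly_Mapping.keys (var 0 :: 'a mpol) \<subseteq> expvecs {0..d}"
      by (auto simp: var_def monom_def expvecs_def)
    have "Poly_Mapping.keys (monom (\<alpha> v) :: 'a mpol) \<subseteq> expvecs {0..d}" if "v \<noteq> 0"
      using assms[of v] that \<open>v \<in> {0..k}\<close> by (fastforce simp: monom_def expvecs_def)
    with 1 show ?thesis
      by (cases "v = 0") (simp_all add: homog_image_def mpoly_mult_closed)
  qed
  then show "poly_subst (homog_image \<alpha>) p \<in> carrier (mpoly_ring {0..d})"
    if "p \<in> carrier (mpoly_ring {0..k})" for p :: "'a mpol"
    using that poly_subst_closed[of p "{0..k}" "homog_image \<alpha>"] by auto
  show "poly_subst (homog_image \<alpha>) \<one>\<^bsub>mpoly_ring {0..k}\<^esub> = (\<one>\<^bsub>mpoly_ring {0..d}\<^esub> :: 'a mpol)"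
    using poly_subst_const[of "homog_image \<alpha>" "1::'a"] by (simp add: const_def)
qed (simp_all add: poly_subst_add poly_subst_mult)

end

theory Submission
  imports Defs
begin

text \<open>
  A polynomial lies in the homogenized toric ideal iff its coefficients sum to zero over every fibre
  of the exponent map of the parametrization, and all fibres are finite by homogeneity. A monomial
  that is not minimal in its fibre is a leading monomial of the ideal, so in an element of the
  reduced Groebner basis every monomial except the leading one is the minimum of its fibre; hence
  the element is a binomial \<open>u - v\<close> with \<open>u\<close> and \<open>v\<close> in one fibre. Since \<open>t\<close> can be cancelled in the ideal and is
  the largest variable, \<open>v\<close> does not involve \<open>t\<close>. Rewriting a monomial whose \<open>t\<close>-exponent is at most
  \<open>j\<close> therefore never increases that exponent, uses only basis elements with \<open>t\<close>-exponent at
  most \<open>j\<close>, and ends in the minimum of the fibre; setting \<open>t = 1\<close> along the way gives \<open>I\<^sub>j \<subseteq> J\<^sub>j\<close>.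
\<close>

subsection \<open>Polynomials and ideals\<close>

lemma monom_mult: "monom m * monom n = (monom (m + n) :: 'a::comm_ring_1 mpol)"
  by (simp add: monom_def mult_single)

lemma monom_power: "monom m ^ n = (monom (of_nat n * m) :: 'a::comm_ring_1 mpol)"
  by (induction n) (simp_all add: monom_mult algebra_simps, simp add: monom_def)

lemma var_power: "var v ^ n = (monom (Poly_Mapping.single v n) :: 'a::comm_ring_1 mpol)"
proof (induction n)
  case 0
  show ?case by (simp add: monom_def)
next
  case (Suc n)
  then show ?case
    by (simp add: var_def monom_mult flip: single_add)
qed

lemma prod_monom: "(\<Prod>x\<in>A. monom (f x)) = (monom (\<Sum>x\<in>A. f x) :: 'a::comm_ring_1 mpol)"
  by (induction A rule: infinite_finite_induct) (simp_all add: monom_mult, simp_all add: monom_def)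

text \<open>The product of exponent vectors is convolution, so \<open>of_nat n\<close> acts as the
  constant \<open>n\<close>; this identifies \<open>of_nat n * e\<close> as the scalar multiple used
  throughout.\<close>

lemma lookup_of_nat_mult:
  "Poly_Mapping.lookup (of_nat n * e) v = n * Poly_Mapping.lookup (e :: expvec) v"
  by (induction n) (simp_all add: distrib_right lookup_add)

lemma lookup_monom:
  "Poly_Mapping.lookup (monom m :: 'a::comm_ring_1 mpol) n = (if m = n then 1 else 0)"
  by (simp add: monom_def lookup_single when_def)

lemma keys_monom [simp]: "Poly_Mapping.keys (monom m :: 'a::field mpol) = {m}"
  by (simp add: monom_def)

lemma keys_monom_diff:
  "m \<noteq> n \<Longrightarrow> Poly_Mapping.keys (monom m - monom n :: 'a::field mpol) = {m, n}"
  by (auto simp: in_keys_iff lookup_minus lookup_monom split: if_splits)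

lemma keys_monom_diff_subset:
  "Poly_Mapping.keys (monom m - monom n :: 'a::field mpol) \<subseteq> {m, n}"
  by (cases "m = n") (simp_all add: keys_monom_diff)

lemma lookup_eq_0_if_expvecs: "m \<in> expvecs X \<Longrightarrow> v \<notin> X \<Longrightarrow> Poly_Mapping.lookup m v = 0"
  by (auto simp: expvecs_def in_keys_iff)

text \<open>Exponents are natural numbers, so a variable of one summand cannot cancel in the
  sum.\<close>

lemma expvecs_addD: "m + n \<in> expvecs X \<Longrightarrow> m \<in> expvecs X \<and> n \<in> expvecs X"
  by (auto simp: expvecs_def in_keys_iff lookup_add subset_iff)

lemma expvecs_mono: "X \<subseteq> Y \<Longrightarrow> expvecs X \<subseteq> expvecs Y"
  by (auto simp: expvecs_def)

lemma single_add_in_expvecs: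
  "z \<in> expvecs {1..k} \<Longrightarrow> Poly_Mapping.single 0 i + z \<in> expvecs {0..k}"
  using expvecs_mono[of "{1..k}" "{0..k}"]
  by (intro expvecs_add) (auto simp: expvecs_def[of "{0..k}"])

section \<open>Ideals of the polynomial ring\<close>

lemma ideal_mpoly_genideal:
  fixes S :: "'a::comm_ring_1 mpol set"
  assumes "S \<subseteq> carrier (mpoly_ring X)"
  shows "ideal (Idl\<^bsub>mpoly_ring X\<^esub> S) (mpoly_ring X)"
  by (rule ring.genideal_ideal[OF cring.axioms(1)[OF cring_mpoly_ring] assms])

lemma
  fixes J :: "'a::comm_ring_1 mpol set"
  assumes "ideal J (mpoly_ring X)"
  shows mpoly_ideal_zero: "0 \<in> J"
    and mpoly_ideal_add: "p \<in> J \<Longrightarrow> q \<in> J \<Longrightarrow> p + q \<in> J"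
    and mpoly_ideal_mult: "p \<in> J \<Longrightarrow> Poly_Mapping.keys c \<subseteq> expvecs X \<Longrightarrow> c * p \<in> J"
    and mpoly_ideal_uminus: "p \<in> J \<Longrightarrow> - p \<in> J"
    and mpoly_ideal_diff: "p \<in> J \<Longrightarrow> q \<in> J \<Longrightarrow> p - q \<in> J"
proof -
  interpret ideal J "mpoly_ring X" by fact
  show "0 \<in> J" using additive_subgroup.zero_closed[OF is_additive_subgroup] by simp
  show add: "p + q \<in> J" if "p \<in> J" "q \<in> J" for p q using additive_subgroup.a_closed[OF is_additive_subgroup that] by simp
  show mult: "c * p \<in> J" if "p \<in> J" "Poly_Mapping.keys c \<subseteq> expvecs X" for c p
    using I_l_closed[of p c] that by simp
  show neg: "- p \<in> J" if "p \<in> J" for p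
    using mult[OF that, of "- 1"] by (simp add: expvecs_0)
  show "p - q \<in> J" if "p \<in> J" "q \<in> J" using add[OF that(1) neg[OF that(2)]] by simp
qed

text \<open>Multiplication by \<open>c\<close> only shifts exponents, so divisibility by an element
  of \<open>U\<close> persists. This support description of a monomial ideal bounds lead ideals from
  above.\<close>

lemma ideal_multiples_of_monomials:
  "ideal {p :: 'a::comm_ring_1 mpol.
     Poly_Mapping.keys p \<subseteq> {m \<in> expvecs X. \<exists>u\<in>U. \<exists>q. m = u + q}} (mpoly_ring X)"
    (is "ideal ?M _")
proof (rule idealI)
  show "ring (mpoly_ring X :: 'a mpol ring)"
    by (rule cring.axioms(1)[OF cring_mpoly_ring])
  then interpret ring "mpoly_ring X :: 'a mpol ring" .
  show "subgroup ?M (add_monoid (mpoly_ring X))"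
  proof (rule add.subgroupI)
    fix p assume "p \<in> ?M"
    moreover have "\<ominus>\<^bsub>mpoly_ring X\<^esub> p = - p"
      by (rule minus_equality) (use \<open>p \<in> ?M\<close> in auto)
    ultimately show "\<ominus>\<^bsub>mpoly_ring X\<^esub> p \<in> ?M" by simp
  next
    fix p q assume "p \<in> ?M" "q \<in> ?M"
    then show "p \<oplus>\<^bsub>mpoly_ring X\<^esub> q \<in> ?M"
      using Poly_Mapping.keys_add[of p q] by auto
  next
    have "0 \<in> ?M" by simp
    then show "?M \<noteq> {}" by blast
  qed auto
  have mult: "c * p \<in> ?M" if "p \<in> ?M" "Poly_Mapping.keys c \<subseteq> expvecs X" for p c
  proof -
    have "a + b \<in> expvecs X \<and> (\<exists>u\<in>U. \<exists>q. a + b = u + q)"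
      if "a \<in> Poly_Mapping.keys c" "b \<in> Poly_Mapping.keys p" for a b
    proof -
      from that(2) \<open>p \<in> ?M\<close> obtain u q where "u \<in> U" "b = u + q" "b \<in> expvecs X" by blast
      then have "a + b = u + (a + q)" by (simp add: ac_simps)
      then show ?thesis
        using \<open>u \<in> U\<close> \<open>b \<in> expvecs X\<close> \<open>Poly_Mapping.keys c \<subseteq> _\<close> that(1) expvecs_add by blast
    qed
    then show ?thesis
      using Poly_Mapping.keys_mult[of c p] by blast
  qed
  show "x \<otimes>\<^bsub>mpoly_ring X\<^esub> p \<in> ?M" if "p \<in> ?M" "x \<in> carrier (mpoly_ring X)" for p x
    using mult[of p x] that by simp
  show "p \<otimes>\<^bsub>mpoly_ring X\<^esub> x \<in> ?M" if "p \<in> ?M" "x \<in> carrier (mpoly_ring X)" for p x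
    using mult[of p x] that by (simp add: mult.commute)
qed

subsection \<open>Lexicographic orders and leading monomials\<close>

locale lex_order =
  fixes X :: "nat set" and r :: "nat rel"
  assumes finite_X: "finite X" and linear: "linear_order_on X r"
begin

abbreviation lt :: "expvec \<Rightarrow> expvec \<Rightarrow> bool" where "lt \<equiv> lex_less X r"

lemma r_trans: "(u, v) \<in> r \<Longrightarrow> (v, w) \<in> r \<Longrightarrow> (u, w) \<in> r"
  using linear unfolding order_on_defs by (elim conjE) (rule transD)

lemma r_antisym: "(u, v) \<in> r \<Longrightarrow> (v, u) \<in> r \<Longrightarrow> u = v"
  using linear unfolding order_on_defs by (elim conjE) (rule antisymD)

lemma r_total: "u \<in> X \<Longrightarrow> v \<in> X \<Longrightarrow> (u, v) \<in> r \<or> (v, u) \<in> r"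
  using linear unfolding order_on_defs by (metis refl_onD total_on_def)

lemma lt_irrefl: "\<not> lt m m"
  by (simp add: lex_less_def)

lemma ltI:
  assumes "v \<in> X" "Poly_Mapping.lookup m v < Poly_Mapping.lookup n v"
    and "\<And>u. u \<in> X \<Longrightarrow> (v, u) \<in> r \<Longrightarrow> u \<noteq> v \<Longrightarrow> Poly_Mapping.lookup m u = Poly_Mapping.lookup n u"
  shows "lt m n"
  unfolding lex_less_def using assms by blast

lemma ltE:
  assumes "lt m n"
  obtains v where "v \<in> X" "Poly_Mapping.lookup m v < Poly_Mapping.lookup n v"
    and "\<And>u. u \<in> X \<Longrightarrow> (v, u) \<in> r \<Longrightarrow> u \<noteq> v \<Longrightarrow> Poly_Mapping.lookup m u = Poly_Mapping.lookup n u"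
  using assms unfolding lex_less_def by blast

text \<open>The larger of the two deciding variables \<open>v\<close> and \<open>w\<close> decides
  the comparison of \<open>l\<close> with \<open>n\<close>, since above it all three vectors
  agree.\<close>

lemma lt_trans:
  assumes "lt l m" "lt m n"
  shows "lt l n"
proof -
  from assms(1) obtain v where v: "v \<in> X" "Poly_Mapping.lookup l v < Poly_Mapping.lookup m v"
      "\<And>u. u \<in> X \<Longrightarrow> (v, u) \<in> r \<Longrightarrow> u \<noteq> v \<Longrightarrow> Poly_Mapping.lookup l u = Poly_Mapping.lookup m u"
    by (rule ltE) iprover
  from assms(2) obtain w where w: "w \<in> X" "Poly_Mapping.lookup m w < Poly_Mapping.lookup n w"
      "\<And>u. u \<in> X \<Longrightarrow> (w, u) \<in> r \<Longrightarrow> u \<noteq> w \<Longrightarrow> Poly_Mapping.lookup m u = Poly_Mapping.lookup n u"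
    by (rule ltE) iprover
  consider "v = w" | "v \<noteq> w" "(v, w) \<in> r" | "v \<noteq> w" "(w, v) \<in> r"
    using r_total[OF v(1) w(1)] by blast
  then show ?thesis
  proof cases
    case 1
    show ?thesis
    proof (rule ltI[OF v(1)])
      show "Poly_Mapping.lookup l v < Poly_Mapping.lookup n v"
        using v(2) w(2) 1 by simp
      show "Poly_Mapping.lookup l u = Poly_Mapping.lookup n u"
        if "u \<in> X" "(v, u) \<in> r" "u \<noteq> v" for u
        using v(3)[of u] w(3)[of u] 1 that by simp
    qed
  next
    case 2
    show ?thesis
    proof (rule ltI[OF w(1)])
      show "Poly_Mapping.lookup l w < Poly_Mapping.lookup n w"
        using v(3)[of w] w(1,2) 2 by simp
      fix u assume u: "u \<in> X" "(w, u) \<in> r" "u \<noteq> w"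
      have "(v, u) \<in> r" using 2(2) u(2) by (rule r_trans)
      moreover have "u \<noteq> v" using 2 u(2) r_antisym[of v w] by auto
      ultimately show "Poly_Mapping.lookup l u = Poly_Mapping.lookup n u"
        using v(3)[of u] w(3)[of u] u by simp
    qed
  next
    case 3
    show ?thesis
    proof (rule ltI[OF v(1)])
      show "Poly_Mapping.lookup l v < Poly_Mapping.lookup n v"
        using w(3)[of v] v(1,2) 3 by simp
      fix u assume u: "u \<in> X" "(v, u) \<in> r" "u \<noteq> v"
      have "(w, u) \<in> r" using 3(2) u(2) by (rule r_trans)
      moreover have "u \<noteq> w" using 3 u(2) r_antisym[of v w] by auto
      ultimately show "Poly_Mapping.lookup l u = Poly_Mapping.lookup n u"
        using v(3)[of u] w(3)[of u] u by simp
    qed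
  qed
qed

lemma r_greatest:
  assumes "finite D" "D \<noteq> {}" "D \<subseteq> X"
  shows "\<exists>v\<in>D. \<forall>u\<in>D. (u, v) \<in> r"
  using assms
proof (induction D rule: finite_ne_induct)
  case (singleton x)
  then show ?case using r_total[of x x] by simp
next
  case (insert x D)
  then obtain v where v: "v \<in> D" "\<forall>u\<in>D. (u, v) \<in> r" by auto
  have "(x, x) \<in> r" using r_total[of x x] insert.prems by simp
  have "(x, v) \<in> r \<or> (v, x) \<in> r" using r_total[of x v] insert.prems v(1) by blast
  then show ?case
  proof
    assume "(x, v) \<in> r"
    with v show ?thesis by blast
  next
    assume "(v, x) \<in> r"
    with v(2) have "\<forall>u\<in>D. (u, x) \<in> r" using r_trans by blast
    with \<open>(x, x) \<in> r\<close> show ?thesis by blast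
  qed
qed

text \<open>The greatest variable in which the vectors differ decides; it exists because
  \<open>X\<close> is finite.\<close>

lemma lt_total:
  assumes "m \<in> expvecs X" "n \<in> expvecs X" "m \<noteq> n"
  shows "lt m n \<or> lt n m"
proof -
  let ?D = "{v \<in> X. Poly_Mapping.lookup m v \<noteq> Poly_Mapping.lookup n v}"
  obtain v where "Poly_Mapping.lookup m v \<noteq> Poly_Mapping.lookup n v"
    using assms(3) by (meson poly_mapping_eqI)
  moreover from this have "v \<in> X"
    using assms lookup_eq_0_if_expvecs by metis
  ultimately have "?D \<noteq> {}" by blast
  then obtain w where w: "w \<in> ?D" "\<forall>u\<in>?D. (u, w) \<in> r"
    using r_greatest[of ?D] finite_X by auto
  then have "\<forall>u\<in>X. (w, u) \<in> r \<and> u \<noteq> w \<longrightarrow> Poly_Mapping.lookup m u = Poly_Mapping.lookup n u"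
    using r_antisym by blast
  then have eq: "Poly_Mapping.lookup m u = Poly_Mapping.lookup n u"
    if "u \<in> X" "(w, u) \<in> r" "u \<noteq> w" for u
    using that by blast
  from w(1) have "w \<in> X" by simp
  from w(1) consider "Poly_Mapping.lookup m w < Poly_Mapping.lookup n w"
    | "Poly_Mapping.lookup n w < Poly_Mapping.lookup m w" by fastforce
  then show ?thesis
    using ltI[OF \<open>w \<in> X\<close> _ eq] ltI[OF \<open>w \<in> X\<close> _ eq[symmetric]] by cases blast+
qed

lemma lt_add_right: "lt m n \<Longrightarrow> lt (m + l) (n + l)"
  by (simp add: lex_less_def lookup_add)

lemma lt_add_right_cancel: "lt (m + l) (n + l) \<Longrightarrow> lt m n"
  by (simp add: lex_less_def lookup_add)

text \<open>No exponent drops when passing to a multiple, so no variable can decide in this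
  direction.\<close>

lemma not_lt_add_self: "\<not> lt (m + l) m"
  by (simp add: lex_less_def lookup_add)

section \<open>Leading monomials and lead ideals\<close>

lemma lt_greatest:
  assumes "finite A" "A \<noteq> {}" "A \<subseteq> expvecs X"
  shows "\<exists>m\<in>A. \<forall>n\<in>A. n \<noteq> m \<longrightarrow> lt n m"
  using assms
proof (induction A rule: finite_ne_induct)
  case (insert x A)
  then obtain m where m: "m \<in> A" "\<forall>n\<in>A. n \<noteq> m \<longrightarrow> lt n m" by auto
  have "lt x m \<or> lt m x"
    using lt_total[of x m] insert.hyps insert.prems m(1) by auto
  then show ?case
  proof
    assume "lt x m"
    with m show ?thesis by blast
  next
    assume "lt m x"
    with m(2) have "\<forall>n\<in>A. lt n x" using lt_trans[of _ m x] by metis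
    then show ?thesis by blast
  qed
qed simp

lemma lead_monom_eqI:
  assumes "m \<in> Poly_Mapping.keys p" "\<And>n. n \<in> Poly_Mapping.keys p \<Longrightarrow> n \<noteq> m \<Longrightarrow> lt n m"
  shows "lead_monom lt p = m"
  unfolding lead_monom_def
proof (rule the_equality)
  fix m' assume m': "m' \<in> Poly_Mapping.keys p \<and> (\<forall>n\<in>Poly_Mapping.keys p. n \<noteq> m' \<longrightarrow> lt n m')"
  show "m' = m"
  proof (rule ccontr)
    assume "m' \<noteq> m"
    with m' assms have "lt m m'" "lt m' m" by auto
    then show False using lt_trans lt_irrefl by blast
  qed
qed (use assms in auto)

lemma
  assumes "Poly_Mapping.keys p \<subseteq> expvecs X" "p \<noteq> 0"
  shows lead_monom_in_keys: "lead_monom lt p \<in> Poly_Mapping.keys p"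
    and lt_lead_monom: "n \<in> Poly_Mapping.keys p \<Longrightarrow> n \<noteq> lead_monom lt p \<Longrightarrow> lt n (lead_monom lt p)"
proof -
  obtain m where m: "m \<in> Poly_Mapping.keys p" "\<forall>n\<in>Poly_Mapping.keys p. n \<noteq> m \<longrightarrow> lt n m"
    using lt_greatest[of "Poly_Mapping.keys p"] assms by auto
  then have "lead_monom lt p = m" by (intro lead_monom_eqI) auto
  with m show "lead_monom lt p \<in> Poly_Mapping.keys p"
    "n \<in> Poly_Mapping.keys p \<Longrightarrow> n \<noteq> lead_monom lt p \<Longrightarrow> lt n (lead_monom lt p)" by auto
qed

lemma lead_terms_in_carrier:
  assumes "F \<subseteq> carrier (mpoly_ring X)"
  shows "lead_term lt ` (F - {0}) \<subseteq> carrier (mpoly_ring X)"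
proof -
  have "lead_monom lt f \<in> expvecs X" if "f \<in> F - {0}" for f
    using lead_monom_in_keys[of f] that assms by auto
  then show ?thesis by (auto simp: lead_term_def split: if_splits)
qed

lemma lead_term_in_lead_ideal:
  assumes "F \<subseteq> carrier (mpoly_ring X)" "f \<in> F" "f \<noteq> 0"
  shows "lead_term lt f \<in> lead_ideal X lt F"
  unfolding lead_ideal_def
  using ring.genideal_self[OF cring.axioms(1)[OF cring_mpoly_ring] lead_terms_in_carrier[OF assms(1)]]
    assms by blast

text \<open>Over a field the lead terms generate the same ideal as the lead monomials, and a
  monomial lies in a monomial ideal exactly if a generator divides it. This turns both the Groebner
  property and reducedness into divisibility statements.\<close>

lemma monom_in_lead_ideal_iff:
  fixes F :: "'a::field mpol set"
  assumes F: "F \<subseteq> carrier (mpoly_ring X)" and m: "m \<in> expvecs X"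
  shows "monom m \<in> lead_ideal X lt F \<longleftrightarrow> (\<exists>f\<in>F - {0}. \<exists>q. m = lead_monom lt f + q)"
proof
  let ?U = "lead_monom lt ` (F - {0})"
  let ?M = "{p :: 'a mpol. Poly_Mapping.keys p \<subseteq> {m \<in> expvecs X. \<exists>u\<in>?U. \<exists>q. m = u + q}}"
  have "lead_term lt ` (F - {0}) \<subseteq> ?M"
  proof
    fix p assume "p \<in> lead_term lt ` (F - {0})"
    then obtain f where f: "f \<in> F - {0}" "p = lead_term lt f" by blast
    then have "lead_monom lt f \<in> expvecs X"
      using lead_monom_in_keys[of f] F by auto
    moreover have "\<exists>u\<in>?U. \<exists>q. lead_monom lt f = u + q"
      using f(1) by (intro bexI[of _ "lead_monom lt f"] exI[of _ 0]) auto
    ultimately show "p \<in> ?M"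
      by (simp add: f(2) lead_term_def)
  qed
  then have "lead_ideal X lt F \<subseteq> ?M"
    unfolding lead_ideal_def
    by (rule ring.genideal_minimal[OF cring.axioms(1)[OF cring_mpoly_ring] ideal_multiples_of_monomials])
  moreover assume "monom m \<in> lead_ideal X lt F"
  ultimately have "monom m \<in> ?M" by blast
  then show "\<exists>f\<in>F - {0}. \<exists>q. m = lead_monom lt f + q" by auto
next
  assume "\<exists>f\<in>F - {0}. \<exists>q. m = lead_monom lt f + q"
  then obtain f q where f: "f \<in> F" "f \<noteq> 0" "m = lead_monom lt f + q" by blast
  let ?c = "Poly_Mapping.lookup f (lead_monom lt f)"
  have "?c \<noteq> 0"
    using lead_monom_in_keys[of f] f F by (auto simp: in_keys_iff)
  then have "monom m = Poly_Mapping.single q (1 / ?c) * lead_term lt f"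
    by (simp add: f(3) lead_term_def lead_coeff_def mult_single monom_def add.commute)
  moreover have "q \<in> expvecs X" using m f(3) expvecs_addD by blast
  moreover have "ideal (lead_ideal X lt F) (mpoly_ring X)"
    unfolding lead_ideal_def by (rule ideal_mpoly_genideal[OF lead_terms_in_carrier[OF F]])
  ultimately show "monom m \<in> lead_ideal X lt F"
    using lead_term_in_lead_ideal[OF F f(1,2)] by (auto intro!: mpoly_ideal_mult split: if_splits)
qed

end

subsection \<open>Fibres of the homogenized parametrization\<close>

text \<open>The additive map on exponents behind the parametrization: \<open>t\<close> goes to (1,0)
  and the variable of index \<open>v\<close> to (1,\<alpha> v), with coordinate 0 for the exponent
  of \<open>s_0\<close>. The case split keeps the arbitrary value \<open>\<alpha> 0\<close>
  out.\<close>

definition homog_exp :: "nat \<Rightarrow> (nat \<Rightarrow> expvec) \<Rightarrow> expvec \<Rightarrow> expvec" where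
  "homog_exp k \<alpha> m = (\<Sum>v=0..k. of_nat (Poly_Mapping.lookup m v) *
     (Poly_Mapping.single 0 1 + (if v = 0 then 0 else \<alpha> v)))"

lemma homog_exp_add: "homog_exp k \<alpha> (m + n) = homog_exp k \<alpha> m + homog_exp k \<alpha> n"
  by (simp add: homog_exp_def lookup_add distrib_right sum.distrib)

lemma prod_homog_image:
  assumes "m \<in> expvecs {0..k}"
  shows "(\<Prod>v\<in>Poly_Mapping.keys m. homog_image \<alpha> v ^ Poly_Mapping.lookup m v) =
    (monom (homog_exp k \<alpha> m) :: 'a::comm_ring_1 mpol)"
proof -
  have "homog_image \<alpha> v =
      (monom (Poly_Mapping.single 0 1 + (if v = 0 then 0 else \<alpha> v)) :: 'a mpol)" for v
    by (simp add: homog_image_def var_def monom_mult)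
  then have "(\<Prod>v=0..k. homog_image \<alpha> v ^ Poly_Mapping.lookup m v) =
      (monom (homog_exp k \<alpha> m) :: 'a mpol)"
    by (simp only: monom_power prod_monom homog_exp_def)
  then show ?thesis
    using assms exp_subst_superset[of "{0..k}" m "homog_image \<alpha> :: nat \<Rightarrow> 'a mpol"] by (simp add: expvecs_def)
qed

lemma lookup_poly_subst_homog_image:
  assumes "Poly_Mapping.keys p \<subseteq> expvecs {0..k}"
  shows "Poly_Mapping.lookup (poly_subst (homog_image \<alpha>) p) e =
    (\<Sum>m | m \<in> Poly_Mapping.keys p \<and> homog_exp k \<alpha> m = e. Poly_Mapping.lookup p m)"
proof -
  have "poly_subst (homog_image \<alpha>) p =
      (\<Sum>m\<in>Poly_Mapping.keys p. Poly_Mapping.single (homog_exp k \<alpha> m) (Poly_Mapping.lookup p m))"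
    unfolding poly_subst_def
    by (rule sum.cong) (use assms in \<open>auto simp: prod_homog_image const_def monom_def mult_single\<close>)
  then show ?thesis
    by (simp add: lookup_sum lookup_single when_def sum.If_cases Int_def)
qed

text \<open>Each monomial is sent to a single monomial, so the coefficient of the image at
  \<open>e\<close> collects the coefficients of \<open>p\<close> over the fibre of \<open>e\<close>;
  the image vanishes iff all these sums do.\<close>

lemma in_homog_toric_ideal_iff:
  "p \<in> homog_toric_ideal d k \<alpha> \<longleftrightarrow> Poly_Mapping.keys p \<subseteq> expvecs {0..k} \<and>
    (\<forall>e. (\<Sum>m | m \<in> Poly_Mapping.keys p \<and> homog_exp k \<alpha> m = e. Poly_Mapping.lookup p m) = 0)"
proof -
  have "p \<in> homog_toric_ideal d k \<alpha> \<longleftrightarrow>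
      Poly_Mapping.keys p \<subseteq> expvecs {0..k} \<and> poly_subst (homog_image \<alpha>) p = 0"
    by (simp add: homog_toric_ideal_def a_kernel_def kernel_def)
  also have "poly_subst (homog_image \<alpha>) p = 0 \<longleftrightarrow>
      (\<forall>e. Poly_Mapping.lookup (poly_subst (homog_image \<alpha>) p) e = 0)"
    by (metis lookup_zero poly_mapping_eqI)
  finally show ?thesis
    by (auto simp: lookup_poly_subst_homog_image)
qed

lemma monom_diff_in_homog_toric_ideal_iff:
  assumes "m \<in> expvecs {0..k}" "n \<in> expvecs {0..k}"
  shows "monom m - monom n \<in> (homog_toric_ideal d k \<alpha> :: 'a::field mpol set) \<longleftrightarrow>
    homog_exp k \<alpha> m = homog_exp k \<alpha> n"
proof -
  have "poly_subst (homog_image \<alpha>) (monom m - monom n :: 'a mpol) =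
      monom (homog_exp k \<alpha> m) - monom (homog_exp k \<alpha> n)"
  proof -
    have "poly_subst (homog_image \<alpha>) (monom l :: 'a mpol) = monom (homog_exp k \<alpha> l)"
      if "l \<in> expvecs {0..k}" for l
      using prod_homog_image[OF that, of \<alpha>, where 'a = 'a] poly_subst_single[of "homog_image \<alpha>" l "1::'a"]
      by (simp add: monom_def const_def)
    then show ?thesis
      \<comment> \<open>Additivity is applied to
        \<open>(monom m - monom n) + monom n = monom m\<close> and solved for the value at the
        difference.\<close>
      using assms poly_subst_add[of "homog_image \<alpha>" "monom m - monom n :: 'a mpol" "monom n"]
      by (simp add: algebra_simps)
  qed
  moreover have "Poly_Mapping.keys (monom m - monom n :: 'a mpol) \<subseteq> expvecs {0..k}"
    using assms keys_monom_diff_subset[of m n] by blast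
  moreover have "(monom a - monom b :: 'a mpol) = 0 \<longleftrightarrow> a = b" for a b
    using keys_monom_diff[of a b, where 'a = 'a] by (metis diff_self insert_not_empty keys_zero)
  ultimately show ?thesis
    by (simp add: homog_toric_ideal_def a_kernel_def kernel_def)
qed

text \<open>The \<alpha> i have no coordinate 0, so coordinate 0 of the image records exactly the
  total degree, \<open>t\<close> included, while the other coordinates record the semigroup
  element.\<close>

lemma homog_exp_eq_iff:
  assumes \<alpha>: "\<alpha> ` {1..k} \<subseteq> expvecs {1..d}"
  shows "homog_exp k \<alpha> m = homog_exp k \<alpha> n \<longleftrightarrow>
    (\<Sum>v=0..k. Poly_Mapping.lookup m v) = (\<Sum>v=0..k. Poly_Mapping.lookup n v) \<and>
    (\<forall>c. (\<Sum>i=1..k. Poly_Mapping.lookup m i * Poly_Mapping.lookup (\<alpha> i) c) =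
         (\<Sum>i=1..k. Poly_Mapping.lookup n i * Poly_Mapping.lookup (\<alpha> i) c))"
    (is "_ \<longleftrightarrow> ?deg m = ?deg n \<and> (\<forall>c. ?img m c = ?img n c)")
proof -
  have img0: "?img l 0 = 0" for l
    using \<alpha> lookup_eq_0_if_expvecs[of _ "{1..d}" 0] by (auto intro!: sum.neutral)
  have lookup: "Poly_Mapping.lookup (homog_exp k \<alpha> l) c = (if c = 0 then ?deg l else 0) + ?img l c"
    for l c
  proof -
    let ?e = "\<lambda>v. Poly_Mapping.single 0 1 + (if v = 0 then 0 else \<alpha> v)"
    have "Poly_Mapping.lookup (homog_exp k \<alpha> l) c =
        (\<Sum>v=0..k. Poly_Mapping.lookup l v * Poly_Mapping.lookup (?e v) c)"
      by (simp only: homog_exp_def lookup_sum lookup_of_nat_mult)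
    also have "\<dots> = (\<Sum>v=0..k. (if c = 0 then Poly_Mapping.lookup l v else 0) +
        (if v = 0 then 0 else Poly_Mapping.lookup l v * Poly_Mapping.lookup (\<alpha> v) c))"
      by (rule sum.cong) (auto simp: lookup_add lookup_single when_def distrib_left)
    also have "\<dots> = (if c = 0 then ?deg l else 0) + ?img l c"
      by (simp add: sum.distrib sum.atLeast_Suc_atMost)
    finally show ?thesis .
  qed
  show ?thesis
  proof
    assume "homog_exp k \<alpha> m = homog_exp k \<alpha> n"
    then have eq: "(if c = 0 then ?deg m else 0) + ?img m c = (if c = 0 then ?deg n else 0) + ?img n c" for c
      by (simp only: lookup[symmetric])
    have deg: "?deg m = ?deg n" using eq[of 0] unfolding img0 by simp
    moreover have "?img m c = ?img n c" for c
      using eq[of c] unfolding deg by (simp only: add_left_cancel)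
    ultimately show "?deg m = ?deg n \<and> (\<forall>c. ?img m c = ?img n c)" by blast
  next
    assume "?deg m = ?deg n \<and> (\<forall>c. ?img m c = ?img n c)"
    then show "homog_exp k \<alpha> m = homog_exp k \<alpha> n"
      by (intro poly_mapping_eqI) (simp only: lookup)
  qed
qed

text \<open>The total degree is constant on a fibre and bounds every single exponent. This
  finiteness makes rewriting terminate.\<close>

lemma finite_homog_exp_fibre:
  assumes \<alpha>: "\<alpha> ` {1..k} \<subseteq> expvecs {1..d}"
  shows "finite {n \<in> expvecs {0..k}. homog_exp k \<alpha> n = homog_exp k \<alpha> m}" (is "finite ?F")
proof -
  let ?N = "\<Sum>v=0..k. Poly_Mapping.lookup m v"
  let ?B = "{f. \<forall>v. (v \<in> {0..k} \<longrightarrow> f v \<in> {..?N}) \<and> (v \<notin> {0..k} \<longrightarrow> f v = 0)}"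
  have "Poly_Mapping.lookup n \<in> ?B" if "n \<in> ?F" for n
  proof -
    have "(\<Sum>v=0..k. Poly_Mapping.lookup n v) = ?N"
      using that homog_exp_eq_iff[OF \<alpha>, of n m] by blast
    then have "Poly_Mapping.lookup n v \<le> ?N" if "v \<in> {0..k}" for v
      using member_le_sum[OF that, of "Poly_Mapping.lookup n"] by (metis finite_atLeastAtMost zero_le)
    moreover have "Poly_Mapping.lookup n v = 0" if "v \<notin> {0..k}" for v
      using \<open>n \<in> ?F\<close> that lookup_eq_0_if_expvecs by blast
    ultimately show ?thesis by blast
  qed
  then have "Poly_Mapping.lookup ` ?F \<subseteq> ?B" by (rule image_subsetI)
  then have "finite (Poly_Mapping.lookup ` ?F)"
    by (rule finite_subset) (rule finite_set_of_finite_funs[OF finite_atLeastAtMost finite_atMost])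
  then show ?thesis
    by (rule finite_imageD) (rule inj_onI, simp only: lookup_inject)
qed

section \<open>Fibres in terms of factorizations and their lengths\<close>

lemma total_degree_eq_sum:
  assumes "m \<in> expvecs X" "finite X"
  shows "total_degree m = (\<Sum>v\<in>X. Poly_Mapping.lookup m v)"
  unfolding total_degree_def
  by (rule sum.mono_neutral_left) (use assms in \<open>auto simp: expvecs_def in_keys_iff\<close>)

text \<open>Padding \<open>z\<close> with \<open>i\<close> copies of \<open>t\<close> makes up the
  difference in length without changing the semigroup element. This is the dictionary between
  binomials in the toric ideal and pairs of factorizations of one element.\<close>

lemma homog_exp_binomial_iff:
  assumes \<alpha>: "\<alpha> ` {1..k} \<subseteq> expvecs {1..d}"
    and z: "z \<in> expvecs {1..k}" and w: "w \<in> expvecs {1..k}"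
  shows "homog_exp k \<alpha> (Poly_Mapping.single 0 i + z) = homog_exp k \<alpha> w \<longleftrightarrow>
    total_degree w = i + total_degree z \<and> (\<exists>\<gamma>. z \<in> factorizations k \<alpha> \<gamma> \<and> w \<in> factorizations k \<alpha> \<gamma>)"
proof -
  let ?img = "\<lambda>m c. \<Sum>i=1..k. Poly_Mapping.lookup m i * Poly_Mapping.lookup (\<alpha> i) c"
  have deg: "(\<Sum>v=0..k. Poly_Mapping.lookup l v) = total_degree l" if "l \<in> expvecs {1..k}" for l
    by (rule total_degree_eq_sum[symmetric]) (use that in \<open>auto simp: expvecs_def\<close>)
  have "(\<Sum>v=0..k. Poly_Mapping.lookup (Poly_Mapping.single 0 i + z) v) = i + total_degree z"
    by (simp add: lookup_add sum.distrib lookup_single when_def deg[OF z])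
  moreover have "?img (Poly_Mapping.single 0 i + z) = ?img z"
    by (intro ext sum.cong) (auto simp: lookup_add lookup_single)
  then have "?img (Poly_Mapping.single 0 i + z) c = ?img z c" for c by (rule fun_cong)
  ultimately have "homog_exp k \<alpha> (Poly_Mapping.single 0 i + z) = homog_exp k \<alpha> w \<longleftrightarrow>
      i + total_degree z = total_degree w \<and> (\<forall>c. ?img z c = ?img w c)"
    by (subst homog_exp_eq_iff[OF \<alpha>]) (simp_all only: deg[OF w])
  moreover have "(\<forall>c. ?img z c = ?img w c) \<longleftrightarrow>
      (\<exists>\<gamma>. z \<in> factorizations k \<alpha> \<gamma> \<and> w \<in> factorizations k \<alpha> \<gamma>)"
  proof
    assume eq: "\<forall>c. ?img z c = ?img w c"
    \<comment> \<open>The common element is the one that \<open>z\<close> factors; by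
      \<open>eq\<close>, \<open>w\<close> factors it too.\<close>
    let ?\<gamma> = "\<Sum>i=1..k. of_nat (Poly_Mapping.lookup z i) * \<alpha> i"
    have "Poly_Mapping.lookup ?\<gamma> c = ?img z c" for c
      by (simp add: lookup_sum lookup_of_nat_mult)
    with eq z w have "z \<in> factorizations k \<alpha> ?\<gamma> \<and> w \<in> factorizations k \<alpha> ?\<gamma>"
      by (simp add: factorizations_def)
    then show "\<exists>\<gamma>. z \<in> factorizations k \<alpha> \<gamma> \<and> w \<in> factorizations k \<alpha> \<gamma>" by blast
  qed (auto simp: factorizations_def)
  ultimately show ?thesis
    by (simp only: eq_commute[of "total_degree w" "i + total_degree z"])
qed

text \<open>A factorization displays \<gamma> as a sum of multiples of generators. This supplies
  \<open>\<gamma> \<in> \<Gamma>\<close> for binomials read off from the Groebner basis.\<close>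

lemma factorizations_nonempty_in_span:
  assumes "z \<in> factorizations k \<alpha> \<gamma>"
  shows "\<gamma> \<in> submonoid_span (\<alpha> ` {1..k})"
proof -
  let ?S = "submonoid_span (\<alpha> ` {1..k})"
  have "\<gamma> = (\<Sum>i=1..k. of_nat (Poly_Mapping.lookup z i) * \<alpha> i)"
    using assms by (intro poly_mapping_eqI) (simp add: factorizations_def lookup_sum lookup_of_nat_mult)
  moreover have "of_nat n * a \<in> ?S" if "a \<in> \<alpha> ` {1..k}" for n a
    by (induction n) (use that in \<open>simp_all add: distrib_right submonoid_span.intros\<close>)
  then have "(\<Sum>i\<in>A. of_nat (Poly_Mapping.lookup z i) * \<alpha> i) \<in> ?S" if "A \<subseteq> {1..k}" for A
    using that by (induction A rule: infinite_finite_induct) (auto intro: submonoid_span.intros)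
  ultimately show ?thesis by simp
qed

subsection \<open>The reduced Groebner basis\<close>

text \<open>The effect of setting \<open>t = 1\<close> on a monomial. The truncated subtraction is
  exact here, as it removes precisely the exponent of \<open>t\<close>.\<close>

definition drop_t :: "expvec \<Rightarrow> expvec" where
  "drop_t m = m - Poly_Mapping.single 0 (Poly_Mapping.lookup m 0)"

lemma lookup_drop_t: "Poly_Mapping.lookup (drop_t m) v = (if v = 0 then 0 else Poly_Mapping.lookup m v)"
  by (simp add: drop_t_def lookup_minus lookup_single when_def)

lemma single_add_drop_t: "Poly_Mapping.single 0 (Poly_Mapping.lookup m 0) + drop_t m = m"
  by (rule poly_mapping_eqI) (simp add: lookup_add lookup_drop_t lookup_single when_def)

lemma drop_t_add: "drop_t (m + n) = drop_t m + drop_t n"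
  by (rule poly_mapping_eqI) (simp add: lookup_add lookup_drop_t)

lemma drop_t_single [simp]: "drop_t (Poly_Mapping.single 0 i) = 0"
  by (rule poly_mapping_eqI) (simp add: lookup_drop_t lookup_single)

lemma drop_t_eq_self: "Poly_Mapping.lookup m 0 = 0 \<Longrightarrow> drop_t m = m"
  by (simp add: drop_t_def)

lemma drop_t_in_expvecs: "m \<in> expvecs {0..k} \<Longrightarrow> drop_t m \<in> expvecs {1..k}"
  unfolding expvecs_def by (auto simp: in_keys_iff lookup_drop_t subset_iff split: if_splits)

section \<open>The ideals generated by basis binomials of bounded \<open>t\<close>-exponent after
  setting \<open>t = 1\<close>\<close>

lemma basis_ideal_generators_in_carrier:
  "{monom z - monom w | i z w. z \<in> expvecs {1..k} \<and> w \<in> expvecs {1..k} \<and>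
     var 0 ^ i * monom z - monom w \<in> G \<and> i \<le> j} \<subseteq> carrier (mpoly_ring {1..k} :: 'a::field mpol ring)"
proof -
  have "Poly_Mapping.keys (monom z - monom w :: 'a mpol) \<subseteq> expvecs {1..k}"
    if "z \<in> expvecs {1..k}" "w \<in> expvecs {1..k}" for z w
    using that keys_monom_diff_subset[of z w] by blast
  then show ?thesis by auto
qed

lemma ideal_basis_ideal: "ideal (basis_ideal k G j) (mpoly_ring {1..k})"
  unfolding basis_ideal_def by (rule ideal_mpoly_genideal[OF basis_ideal_generators_in_carrier])

lemma basis_ideal_generator:
  assumes "z \<in> expvecs {1..k}" "w \<in> expvecs {1..k}" "var 0 ^ i * monom z - monom w \<in> G" "i \<le> j"
  shows "monom z - monom w \<in> basis_ideal k G j"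
  unfolding basis_ideal_def
  using ring.genideal_self[OF cring.axioms(1)[OF cring_mpoly_ring] basis_ideal_generators_in_carrier[of k G j]]
    assms by blast

section \<open>Shape of the basis elements, and rewriting with them\<close>

locale homog_groebner =
  fixes d k :: nat and \<alpha> :: "nat \<Rightarrow> expvec" and r :: "nat rel" and G :: "'a::field mpol set"
  assumes \<alpha>: "\<alpha> ` {1..k} \<subseteq> expvecs {1..d}"
    and lin: "linear_order_on {0..k} r"
    and t_greatest: "\<And>i. i \<in> {1..k} \<Longrightarrow> (i, 0) \<in> r"
    and reduced: "reduced_groebner_basis {0..k} (lex_less {0..k} r) (homog_toric_ideal d k \<alpha>) G"
begin

sublocale lex_order "{0..k}" r
  by unfold_locales (use lin in auto)

abbreviation fib :: "expvec \<Rightarrow> expvec" where "fib \<equiv> homog_exp k \<alpha>"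

abbreviation fibre_minimal :: "expvec \<Rightarrow> bool" where
  "fibre_minimal m \<equiv> \<forall>n\<in>expvecs {0..k}. fib n = fib m \<longrightarrow> \<not> lt n m"

lemma toric_subset_carrier: "homog_toric_ideal d k \<alpha> \<subseteq> carrier (mpoly_ring {0..k} :: 'a mpol ring)"
  by (auto simp: in_homog_toric_ideal_iff)

lemma G_subset: "G \<subseteq> homog_toric_ideal d k \<alpha>"
  and lead_ideal_G: "lead_ideal {0..k} lt G = lead_ideal {0..k} lt (homog_toric_ideal d k \<alpha> :: 'a mpol set)"
  and zero_notin_G: "0 \<notin> G"
  using reduced by (simp_all add: reduced_groebner_basis_def groebner_basis_def)

lemma G_subset_carrier: "G \<subseteq> carrier (mpoly_ring {0..k})"
  using G_subset toric_subset_carrier by (rule subset_trans)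

lemma keys_G: "g \<in> G \<Longrightarrow> m \<in> Poly_Mapping.keys g \<Longrightarrow> m \<in> expvecs {0..k}"
  using G_subset_carrier by auto

lemma lead_in_keys_G: "g \<in> G \<Longrightarrow> lead_monom lt g \<in> Poly_Mapping.keys g"
  using lead_monom_in_keys[of g] G_subset_carrier zero_notin_G by auto

text \<open>Reducedness excludes divisibility by the lead monomial of any other basis element. The
  conclusion \<open>g' = g\<close> lets this serve for tail monomials and for the lead monomial of
  \<open>g\<close> alike.\<close>

lemma keys_not_divisible:
  assumes "g \<in> G" "g' \<in> G" "m \<in> Poly_Mapping.keys g" "m = lead_monom lt g' + q"
  shows "g' = g"
proof (rule ccontr)
  assume "g' \<noteq> g"
  with assms(2) zero_notin_G have "g' \<in> G - {g} - {0}" by auto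
  with assms(4) have "monom m \<in> lead_ideal {0..k} lt (G - {g})"
    using monom_in_lead_ideal_iff[of "G - {g}" m] keys_G[OF assms(1,3)] G_subset_carrier by blast
  with assms(1,3) reduced show False
    by (simp add: reduced_groebner_basis_def)
qed

text \<open>The binomial \<open>monom m - monom n\<close> lies in the toric ideal and has lead
  monomial \<open>m\<close>, so the Groebner property makes some lead monomial of \<open>G\<close>
  divide \<open>m\<close>.\<close>

lemma lead_monom_divides_nonminimal:
  assumes m: "m \<in> expvecs {0..k}" and n: "n \<in> expvecs {0..k}" and "fib n = fib m" "lt n m"
  shows "\<exists>g\<in>G. \<exists>q. m = lead_monom lt g + q"
proof -
  let ?p = "monom m - monom n :: 'a mpol"
  have "m \<noteq> n" using assms(4) lt_irrefl by blast
  then have keys: "Poly_Mapping.keys ?p = {m, n}" by (rule keys_monom_diff)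
  then have lm: "lead_monom lt ?p = m"
    using assms(4) by (intro lead_monom_eqI) auto
  then have "lead_term lt ?p = monom m"
    using \<open>m \<noteq> n\<close> unfolding lead_term_def lead_coeff_def lm
    by (simp add: lookup_minus lookup_monom) (simp add: monom_def)
  moreover have "?p \<in> homog_toric_ideal d k \<alpha>"
    using assms by (simp add: monom_diff_in_homog_toric_ideal_iff)
  moreover have "?p \<noteq> 0" using keys by auto
  ultimately have "monom m \<in> lead_ideal {0..k} lt (homog_toric_ideal d k \<alpha> :: 'a mpol set)"
    using lead_term_in_lead_ideal[OF toric_subset_carrier] by metis
  then show ?thesis
    using monom_in_lead_ideal_iff[OF G_subset_carrier m] lead_ideal_G by blast
qed

text \<open>If \<open>n\<close> were not minimal, a lead monomial of \<open>G\<close> would divide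
  it, by reducedness that of \<open>g\<close> itself; but \<open>n\<close> is smaller than this
  monomial and so is no multiple of it.\<close>

lemma tail_minimal:
  assumes "g \<in> G" "n \<in> Poly_Mapping.keys g" "n \<noteq> lead_monom lt g"
  shows "fibre_minimal n"
proof (intro ballI impI notI)
  fix n' assume "n' \<in> expvecs {0..k}" "fib n' = fib n" "lt n' n"
  then obtain g' q where "g' \<in> G" "n = lead_monom lt g' + q"
    using lead_monom_divides_nonminimal keys_G[OF assms(1,2)] by blast
  with assms have "n = lead_monom lt g + q"
    using keys_not_divisible by blast
  moreover have "lt n (lead_monom lt g)"
    using assms lt_lead_monom[of g n] G_subset_carrier zero_notin_G by auto
  ultimately show False using not_lt_add_self by blast
qed

lemma fibre_minimal_unique:
  "m \<in> expvecs {0..k} \<Longrightarrow> n \<in> expvecs {0..k} \<Longrightarrow> fib m = fib n \<Longrightarrow>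
    fibre_minimal m \<Longrightarrow> fibre_minimal n \<Longrightarrow> m = n"
  using lt_total[of m n] by auto

text \<open>By minimality each fibre contains at most one tail monomial. Since coefficients sum to
  zero over every fibre, the tail has no monomial outside the fibre of the lead monomial, and inside
  it exactly one, with coefficient -1.\<close>

lemma G_binomial:
  assumes g: "g \<in> G"
  obtains n where "n \<in> expvecs {0..k}" "fib n = fib (lead_monom lt g)" "lt n (lead_monom lt g)"
    "g = monom (lead_monom lt g) - monom n"
proof -
  let ?u = "lead_monom lt g"
  let ?K = "Poly_Mapping.keys g"
  have u: "?u \<in> ?K" by (rule lead_in_keys_G[OF g])
  have lc: "Poly_Mapping.lookup g ?u = 1"
    using reduced g by (simp add: reduced_groebner_basis_def lead_coeff_def)
  have sum0: "(\<Sum>m | m \<in> ?K \<and> fib m = e. Poly_Mapping.lookup g m) = 0" for e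
    using g G_subset by (auto simp: in_homog_toric_ideal_iff)
  have unique: "m = n" if "m \<in> ?K" "n \<in> ?K" "m \<noteq> ?u" "n \<noteq> ?u" "fib m = fib n" for m n
    using that fibre_minimal_unique[of m n] tail_minimal[OF g] keys_G[OF g] by blast
  have fib_u: "fib n = fib ?u" if "n \<in> ?K" for n
  proof (rule ccontr)
    assume ne: "fib n \<noteq> fib ?u"
    \<comment> \<open>Monomials in this fibre differ from the lead monomial, so
      \<open>unique\<close> applies and the zero fibre sum is the single coefficient of
      \<open>n\<close>.\<close>
    have "{m. m \<in> ?K \<and> fib m = fib n} = {n}"
      using unique[OF _ that] that ne by (intro equalityI subsetI) (simp, metis, simp)
    then have "Poly_Mapping.lookup g n = 0" using sum0[of "fib n"] by simp
    with that show False by (simp add: in_keys_iff)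
  qed
  then have "{m. m \<in> ?K \<and> fib m = fib ?u} = ?K" by blast
  with sum0[of "fib ?u"] have sumK: "(\<Sum>m\<in>?K. Poly_Mapping.lookup g m) = 0" by simp
  \<comment> \<open>The lead coefficient 1 alone cannot sum to zero, so a tail monomial
    exists.\<close>
  have "?K \<noteq> {?u}" using sumK lc by auto
  with u obtain n where n: "n \<in> ?K" "n \<noteq> ?u" by blast
  have "x = n" if "x \<in> ?K" "x \<noteq> ?u" for x
    using unique[OF that(1) n(1) that(2) n(2)] fib_u[OF that(1)] fib_u[OF n(1)] by simp
  with u n(1) have K: "?K = {?u, n}" by blast
  with sumK n lc have "Poly_Mapping.lookup g n = - 1"
    by (simp add: add_eq_0_iff)
  moreover have "Poly_Mapping.lookup g x = 0" if "x \<noteq> ?u" "x \<noteq> n" for x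
    using that K by (metis empty_iff in_keys_iff insert_iff)
  ultimately have "g = monom ?u - monom n"
    using n lc by (intro poly_mapping_eqI) (auto simp: lookup_minus lookup_monom)
  moreover have "lt n ?u"
    using n lt_lead_monom[of g n] g G_subset_carrier zero_notin_G by auto
  ultimately show thesis
    using that n fib_u keys_G[OF g] by blast
qed

text \<open>As \<open>t\<close> is the greatest variable, either it decides the comparison or its
  two exponents agree.\<close>

lemma lt_imp_lookup_0_le: "lt n m \<Longrightarrow> Poly_Mapping.lookup n 0 \<le> Poly_Mapping.lookup m 0"
proof -
  assume "lt n m"
  then obtain v where v: "v \<in> {0..k}" "Poly_Mapping.lookup n v < Poly_Mapping.lookup m v"
    "\<forall>u\<in>{0..k}. (v, u) \<in> r \<and> u \<noteq> v \<longrightarrow> Poly_Mapping.lookup n u = Poly_Mapping.lookup m u"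
    unfolding lex_less_def by blast
  then show ?thesis
    using t_greatest[of v] by (cases "v = 0") auto
qed

text \<open>If \<open>t\<close> divided the tail, it would divide the lead monomial
  \<open>?u\<close> too. Cancelling it preserves fibre and order, so \<open>?u\<close> divided by
  \<open>t\<close> would still be divisible by a lead monomial, by reducedness \<open>?u\<close>
  itself, which is absurd.\<close>

lemma G_tail_t_free:
  assumes g: "g \<in> G" and n: "n \<in> expvecs {0..k}" "fib n = fib (lead_monom lt g)" "lt n (lead_monom lt g)"
    "g = monom (lead_monom lt g) - monom n"
  shows "Poly_Mapping.lookup n 0 = 0"
proof (rule ccontr)
  let ?u = "lead_monom lt g"
  let ?t = "Poly_Mapping.single 0 1 :: expvec"
  assume "Poly_Mapping.lookup n 0 \<noteq> 0"
  moreover from this have "Poly_Mapping.lookup ?u 0 \<noteq> 0"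
    using lt_imp_lookup_0_le[OF n(3)] by simp
  \<comment> \<open>Subtraction of exponents is truncated; it can be undone because both
    \<open>t\<close>-exponents are positive.\<close>
  ultimately have n': "n = (n - ?t) + ?t" and u': "?u = (?u - ?t) + ?t"
    by (auto intro!: poly_mapping_eqI simp: lookup_add lookup_minus lookup_single when_def)
  have "?u \<in> expvecs {0..k}" using keys_G[OF g lead_in_keys_G[OF g]] .
  then have "?u - ?t \<in> expvecs {0..k}" "n - ?t \<in> expvecs {0..k}"
    using n(1) n' u' expvecs_addD by metis+
  moreover have "fib (n - ?t) = fib (?u - ?t)"
    using n(2) n' u' homog_exp_add[of k \<alpha> _ ?t] by (metis add_right_cancel)
  moreover have "lt (n - ?t) (?u - ?t)"
    using n(3) n' u' lt_add_right_cancel by metis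
  ultimately obtain g' q where g': "g' \<in> G" "?u - ?t = lead_monom lt g' + q"
    using lead_monom_divides_nonminimal by blast
  then have u: "?u = lead_monom lt g' + (q + ?t)" using u' by (simp add: add.assoc)
  then have "g' = g" using keys_not_divisible[OF g g'(1) lead_in_keys_G[OF g]] by blast
  with u have "q + ?t = 0" by simp
  then have "Poly_Mapping.lookup (q + ?t) 0 = 0" by simp
  then show False by (simp add: lookup_add)
qed

text \<open>Rewriting by a basis element replaces its lead monomial by a smaller,
  \<open>t\<close>-free one in the same fibre, so the \<open>t\<close>-exponent never grows beyond
  \<open>j\<close> and every element used has \<open>t\<close>-exponent at most \<open>j\<close>.
  The induction counts the smaller members of the finite fibre.\<close>

lemma reduce_to_fibre_minimum:
  assumes "m \<in> expvecs {0..k}" "Poly_Mapping.lookup m 0 \<le> j"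
  shows "\<exists>n\<in>expvecs {0..k}. fib n = fib m \<and> fibre_minimal n \<and>
    monom (drop_t m) - monom (drop_t n) \<in> basis_ideal k G j"
  using assms
proof (induction "card {n \<in> expvecs {0..k}. fib n = fib m \<and> lt n m}" arbitrary: m rule: less_induct)
  case less
  show ?case
  proof (cases "fibre_minimal m")
    case True
    then show ?thesis
      using less.prems mpoly_ideal_zero[OF ideal_basis_ideal] by (intro bexI[of _ m]) auto
  next
    case False
    then obtain g q where g: "g \<in> G" "m = lead_monom lt g + q"
      using lead_monom_divides_nonminimal less.prems(1) by blast
    let ?u = "lead_monom lt g"
    obtain w where w: "w \<in> expvecs {0..k}" "fib w = fib ?u" "lt w ?u" "g = monom ?u - monom w"
      using G_binomial[OF g(1)] by blast
    have w0: "Poly_Mapping.lookup w 0 = 0" by (rule G_tail_t_free[OF g(1) w])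
    let ?m = "w + q"
    have u: "?u \<in> expvecs {0..k}" and q: "q \<in> expvecs {0..k}"
      using less.prems(1) g(2) expvecs_addD by blast+
    have m': "?m \<in> expvecs {0..k}" "fib ?m = fib m" "lt ?m m" "Poly_Mapping.lookup ?m 0 \<le> j"
      using w q w0 less.prems(2) g(2) by (simp_all add: expvecs_add homog_exp_add lt_add_right lookup_add)
    have "{n \<in> expvecs {0..k}. fib n = fib ?m \<and> lt n ?m} \<subset> {n \<in> expvecs {0..k}. fib n = fib m \<and> lt n m}"
      using m' lt_trans[of _ ?m m] lt_irrefl[of ?m] by auto
    moreover have "finite {n \<in> expvecs {0..k}. fib n = fib m \<and> lt n m}"
      by (rule finite_subset[OF _ finite_homog_exp_fibre[OF \<alpha>, of m]]) auto
    ultimately have "card {n \<in> expvecs {0..k}. fib n = fib ?m \<and> lt n ?m} <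
        card {n \<in> expvecs {0..k}. fib n = fib m \<and> lt n m}"
      by (rule psubset_card_mono[rotated])
    from less.hyps[OF this m'(1,4)] obtain n where n: "n \<in> expvecs {0..k}" "fib n = fib ?m"
      "fibre_minimal n" "monom (drop_t ?m) - monom (drop_t n) \<in> basis_ideal k G j"
      by blast
    \<comment> \<open>Splitting off the power of \<open>t\<close> in the lead monomial brings
      \<open>g\<close> into the form demanded of generators of \<open>basis_ideal\<close>.\<close>
    have "var 0 ^ Poly_Mapping.lookup ?u 0 * monom (drop_t ?u) - monom w = g"
      using w(4) by (simp add: var_power monom_mult single_add_drop_t)
    moreover have "Poly_Mapping.lookup ?u 0 \<le> j"
      using less.prems(2) g(2) by (metis add_leD1 lookup_add)
    moreover have "w \<in> expvecs {1..k}"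
      using drop_t_in_expvecs[OF w(1)] drop_t_eq_self[OF w0] by simp
    ultimately have "monom (drop_t ?u) - monom w \<in> basis_ideal k G j"
      using g(1) drop_t_in_expvecs[OF u] by (intro basis_ideal_generator) auto
    then have "monom (drop_t q) * (monom (drop_t ?u) - monom w) \<in> basis_ideal k G j"
      by (rule mpoly_ideal_mult[OF ideal_basis_ideal]) (use drop_t_in_expvecs[OF q] in simp)
    \<comment> \<open>The rewriting step from \<open>m\<close> to \<open>?m\<close> at
      \<open>t = 1\<close>: the cofactor \<open>q\<close> enters with its \<open>t\<close>-part
      removed.\<close>
    moreover have "monom (drop_t q) * (monom (drop_t ?u) - monom w) = monom (drop_t m) - (monom (drop_t ?m) :: 'a mpol)"
      by (subst g(2)) (simp add: drop_t_add drop_t_eq_self[OF w0] right_diff_distrib monom_mult add.commute)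
    ultimately have "monom (drop_t m) - monom (drop_t ?m) \<in> basis_ideal k G j" by simp
    from mpoly_ideal_add[OF ideal_basis_ideal this n(4)] n(1-3) m'(2) show ?thesis
      by auto
  qed
qed

text \<open>After padding \<open>z\<close> by \<open>i\<close> copies of \<open>t\<close>, both
  monomials lie in one fibre and have \<open>t\<close>-exponent at most \<open>j\<close>. They
  reduce to the same fibre minimum, and the difference of the two reductions at \<open>t = 1\<close>
  is the binomial.\<close>

lemma binomial_in_basis_ideal:
  assumes z: "z \<in> factorizations k \<alpha> \<gamma>" and w: "w \<in> factorizations k \<alpha> \<gamma>"
    and deg: "total_degree w = i + total_degree z" and "i \<le> j"
  shows "monom z - monom w \<in> basis_ideal k G j"
proof -
  have zw: "z \<in> expvecs {1..k}" "w \<in> expvecs {1..k}"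
    using z w by (simp_all add: factorizations_def)
  let ?m = "Poly_Mapping.single 0 i + z"
  have z0: "Poly_Mapping.lookup z 0 = 0" and w0: "Poly_Mapping.lookup w 0 = 0"
    using zw lookup_eq_0_if_expvecs by auto
  have in_X: "?m \<in> expvecs {0..k}" "w \<in> expvecs {0..k}"
    using zw by (simp_all add: single_add_in_expvecs subsetD[OF expvecs_mono[of "{1..k}" "{0..k}"]])
  have fib: "fib ?m = fib w"
    using homog_exp_binomial_iff[OF \<alpha> zw, of i] z w deg by blast
  have "Poly_Mapping.lookup ?m 0 \<le> j" using \<open>i \<le> j\<close> z0 by (simp add: lookup_add)
  from reduce_to_fibre_minimum[OF in_X(1) this] obtain a where
    a: "a \<in> expvecs {0..k}" "fib a = fib ?m" "fibre_minimal a"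
      "monom (drop_t ?m) - monom (drop_t a) \<in> basis_ideal k G j" by blast
  obtain b where
    b: "b \<in> expvecs {0..k}" "fib b = fib w" "fibre_minimal b"
      "monom (drop_t w) - monom (drop_t b) \<in> basis_ideal k G j"
    using reduce_to_fibre_minimum[OF in_X(2), of j] w0 by auto
  have "a = b" using fibre_minimal_unique a b fib by metis
  with mpoly_ideal_diff[OF ideal_basis_ideal a(4) b(4)] show ?thesis
    by (simp add: drop_t_add drop_t_eq_self z0 w0)
qed

end

section \<open>The two inclusions, each checked on generators\<close>

theorem theorem3p10:
  fixes d k :: nat
    and \<Gamma> :: "expvec set"
    and \<alpha> :: "nat \<Rightarrow> expvec"
    and r :: "nat rel"
    and G :: "'a::field mpol set"
  assumes "affine_semigroup d \<Gamma>"
    and "minimal_generators k \<alpha> \<Gamma>"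
    and "linear_order_on {0..k} r"
    and "\<forall>i\<in>{1..k}. (i, 0) \<in> r"
    and "reduced_groebner_basis {0..k} (lex_less {0..k} r) (homog_toric_ideal d k \<alpha>) G"
  shows "\<forall>j::nat. length_diff_ideal k \<alpha> \<Gamma> j = basis_ideal k G j"
proof
  fix j :: nat
  have span: "submonoid_span (\<alpha> ` {1..k}) = \<Gamma>"
    using assms(2) by (simp add: minimal_generators_def)
  have \<alpha>: "\<alpha> ` {1..k} \<subseteq> expvecs {1..d}"
    using assms(1) span submonoid_span.gen[of _ "\<alpha> ` {1..k}"]
    by (auto simp: affine_semigroup_def)
  interpret homog_groebner d k \<alpha> r G
    by unfold_locales (use \<alpha> assms(3-5) in auto)
  let ?S = "{monom z - monom w :: 'a mpol | \<gamma> z w.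
        \<gamma> \<in> \<Gamma> \<and> z \<in> factorizations k \<alpha> \<gamma> \<and> w \<in> factorizations k \<alpha> \<gamma> \<and>
        \<bar>int (total_degree w) - int (total_degree z)\<bar> \<le> int j}"
  let ?T = "{monom z - monom w :: 'a mpol | i z w. z \<in> expvecs {1..k} \<and> w \<in> expvecs {1..k} \<and>
        var 0 ^ i * monom z - monom w \<in> G \<and> i \<le> j}"
  note ring = cring.axioms(1)[OF cring_mpoly_ring]
  have "?S \<subseteq> basis_ideal k G j"
  proof
    fix p assume "p \<in> ?S"
    then obtain \<gamma> z w where p: "p = monom z - monom w"
      and z: "z \<in> factorizations k \<alpha> \<gamma>" and w: "w \<in> factorizations k \<alpha> \<gamma>"
      and deg: "\<bar>int (total_degree w) - int (total_degree z)\<bar> \<le> int j"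
      by blast
    show "p \<in> basis_ideal k G j"
    \<comment> \<open>The shorter factorization has to be the one padded with \<open>t\<close>; in
      the other case the binomial only changes sign.\<close>
    proof (cases "total_degree z \<le> total_degree w")
      case True
      then show ?thesis
        unfolding p using deg
        by (intro binomial_in_basis_ideal[OF z w, of "total_degree w - total_degree z"]) auto
    next
      case False
      then have "monom w - monom z \<in> basis_ideal k G j"
        using deg by (intro binomial_in_basis_ideal[OF w z, of "total_degree z - total_degree w"]) auto
      from mpoly_ideal_uminus[OF ideal_basis_ideal this] show ?thesis
        by (simp add: p)
    qed
  qed
  then have 1: "length_diff_ideal k \<alpha> \<Gamma> j \<subseteq> basis_ideal k G j"
    unfolding length_diff_ideal_def by (rule ring.genideal_minimal[OF ring ideal_basis_ideal])
  \<comment> \<open>A binomial of \<open>G\<close> with \<open>t\<close>-exponent \<open>i\<close>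
    comes from two factorizations whose lengths differ by exactly \<open>i\<close>, so already the
    generating sets are nested.\<close>
  have "?T \<subseteq> ?S"
  proof
    fix p assume "p \<in> ?T"
    then obtain i z w where p: "p = monom z - monom w" and zw: "z \<in> expvecs {1..k}" "w \<in> expvecs {1..k}"
      and G: "var 0 ^ i * monom z - monom w \<in> G" and i: "i \<le> j"
      by blast
    let ?m = "Poly_Mapping.single 0 i + z"
    have in_X: "?m \<in> expvecs {0..k}" "w \<in> expvecs {0..k}"
      using zw by (simp_all add: single_add_in_expvecs subsetD[OF expvecs_mono[of "{1..k}" "{0..k}"]])
    have "monom ?m - monom w \<in> (homog_toric_ideal d k \<alpha> :: 'a mpol set)"
      using G G_subset by (auto simp: var_power monom_mult)
    then have "fib ?m = fib w"
      by (simp add: monom_diff_in_homog_toric_ideal_iff in_X)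
    then obtain \<gamma> where \<gamma>: "total_degree w = i + total_degree z"
      "z \<in> factorizations k \<alpha> \<gamma>" "w \<in> factorizations k \<alpha> \<gamma>"
      using homog_exp_binomial_iff[OF \<alpha> zw, of i] by blast
    moreover have "\<gamma> \<in> \<Gamma>"
      using factorizations_nonempty_in_span[OF \<gamma>(2)] span by simp
    moreover have "\<bar>int (total_degree w) - int (total_degree z)\<bar> \<le> int j"
      using \<gamma>(1) i by simp
    ultimately show "p \<in> ?S" using p by blast
  qed
  moreover have S: "?S \<subseteq> carrier (mpoly_ring {1..k})"
  proof -
    have "Poly_Mapping.keys (monom z - monom w :: 'a mpol) \<subseteq> expvecs {1..k}"
      if "z \<in> factorizations k \<alpha> \<gamma>" "w \<in> factorizations k \<alpha> \<gamma>" for z w \<gamma>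
      using that keys_monom_diff_subset[of z w] by (auto simp: factorizations_def)
    then show ?thesis by auto
  qed
  ultimately have "basis_ideal k G j \<subseteq> length_diff_ideal k \<alpha> \<Gamma> j"
    unfolding basis_ideal_def length_diff_ideal_def
    using ring.genideal_minimal[OF ring ideal_mpoly_genideal[OF S]] ring.genideal_self[OF ring S]
    by (meson subset_trans)
  with 1 show "length_diff_ideal k \<alpha> \<Gamma> j = basis_ideal k G j" by (rule subset_antisym)
qed

end
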